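(* Let $\Bbbk$ be a field of characteristic zero and let $W_1$ be the first Weyl algebra over $\Bbbk$, i.e., the unital associative algebra generated by two elements $p,q$ with the defining relation $qp-pq=1$. For an arbitrary (not necessarily unital) $W_1$-bimodule $M$, the Hochschild cohomology group $\mathrm H^3(W_1,M)$ is trivial, i.e. $\mathrm H^3(W_1,M)=0$.
   Context: A bimodule $M$ over an associative $\Bbbk$-algebra $A$ is a $\Bbbk$-vector space with commuting left and right associative actions of $A$; here the identity element of $W_1$ is not required to act on $M$ as the identity on either side. $\mathrm H^n(A,M)$ denotes the cohomology of the Hochschild complex $\mathrm C^n(A,M)=\mathrm{Hom}_{\Bbbk}(A^{\otimes n},M)$ with differential $$(\Delta^n f)(a_1,\dots,a_{n+1})=a_1f(a_2,\dots,a_{n+1})+\sum_{i=1}^n(-1)^if(a_1,\dots,a_ia_{i+1},\dots,a_{n+1})+(-1)^{n+1}f(a_1,\dots,a_n)a_{n+1}.$$ *)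

theory Defs
  imports
    Complex_Main
    "HOL-Library.Poly_Mapping"
    "HOL-Computational_Algebra.Polynomial"
    "HOL-Algebra.Elementary_Groups"
begin

section \<open>The first Weyl algebra by generators and relations\<close>

datatype weyl_gen = Gen_p | Gen_q

text \<open>Words in the generators, i.e. the free monoid. A separate type is needed because its
  monoid structure is written additively, as required by the convolution product on
  \<^type>\<open>poly_mapping\<close>.\<close>

datatype weyl_word = Word (letters: "weyl_gen list")

instantiation weyl_word :: monoid_add
begin
definition zero_weyl_word :: weyl_word where "0 = Word []"
definition plus_weyl_word :: "weyl_word \<Rightarrow> weyl_word \<Rightarrow> weyl_word"
  where "u + v = Word (letters u @ letters v)"
instance by standard (auto simp: zero_weyl_word_def plus_weyl_word_def)
end

text \<open>The free algebra on the two generators: finitely supported coefficient functions on words,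
  multiplied by convolution.\<close>

type_synonym 'k weyl_free = "weyl_word \<Rightarrow>\<^sub>0 'k"

definition free_gen :: "weyl_gen \<Rightarrow> 'k::field weyl_free"
  where "free_gen g = Poly_Mapping.single (Word [g]) 1"

text \<open>The two-sided ideal generated by \<open>qp - pq - 1\<close>.\<close>

inductive_set weyl_ideal :: "'k::field weyl_free set" where
  relator: "free_gen Gen_q * free_gen Gen_p - free_gen Gen_p * free_gen Gen_q - 1 \<in> weyl_ideal"
| zero: "0 \<in> weyl_ideal"
| diff: "x \<in> weyl_ideal \<Longrightarrow> y \<in> weyl_ideal \<Longrightarrow> x - y \<in> weyl_ideal"
| mult_left: "x \<in> weyl_ideal \<Longrightarrow> a * x \<in> weyl_ideal"
| mult_right: "x \<in> weyl_ideal \<Longrightarrow> x * a \<in> weyl_ideal"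

lemma weyl_ideal_uminus: "x \<in> weyl_ideal \<Longrightarrow> - x \<in> weyl_ideal"
  using weyl_ideal.diff[OF weyl_ideal.zero] by fastforce

lemma weyl_ideal_add: "x \<in> weyl_ideal \<Longrightarrow> y \<in> weyl_ideal \<Longrightarrow> x + y \<in> weyl_ideal"
  using weyl_ideal.diff[OF _ weyl_ideal_uminus] by fastforce

text \<open>The ideal is proper: the free algebra acts on polynomials with \<open>p\<close> as multiplication by
  the variable and \<open>q\<close> as differentiation, and the ideal acts by zero.\<close>

fun gen_act :: "weyl_gen \<Rightarrow> 'k::field poly \<Rightarrow> 'k poly" where
  "gen_act Gen_p f = pCons 0 f"
| "gen_act Gen_q f = pderiv f"

definition word_act :: "weyl_word \<Rightarrow> 'k::field poly \<Rightarrow> 'k poly"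
  where "word_act w = foldr gen_act (letters w)"

definition free_act :: "'k::field weyl_free \<Rightarrow> 'k poly \<Rightarrow> 'k poly"
  where "free_act x f = (\<Sum>w\<in>Poly_Mapping.keys x. Polynomial.smult (Poly_Mapping.lookup x w) (word_act w f))"

lemma gen_act_add: "gen_act g (f + h) = gen_act g f + gen_act g h"
  by (cases g) (auto simp: pderiv_add)

lemma gen_act_smult: "gen_act g (Polynomial.smult c f) = Polynomial.smult c (gen_act g f)"
  by (cases g) (auto simp: pderiv_smult)

lemma word_act_add: "word_act w (f + h) = word_act w f + word_act w h"
proof -
  have "foldr gen_act gs (f + h) = foldr gen_act gs f + foldr gen_act gs h" for gs
    by (induction gs) (simp_all add: gen_act_add)
  thus ?thesis by (simp add: word_act_def)
qed

lemma word_act_smult: "word_act w (Polynomial.smult c f) = Polynomial.smult c (word_act w f)"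
proof -
  have "foldr gen_act gs (Polynomial.smult c f) = Polynomial.smult c (foldr gen_act gs f)" for gs
    by (induction gs) (simp_all add: gen_act_smult)
  thus ?thesis by (simp add: word_act_def)
qed

lemma word_act_zero [simp]: "word_act w 0 = 0"
  using word_act_smult[of w 0 0] by simp

lemma word_act_plus: "word_act (u + v) f = word_act u (word_act v f)"
  by (simp add: word_act_def plus_weyl_word_def)

lemma word_act_sum: "word_act w (\<Sum>i\<in>I. g i) = (\<Sum>i\<in>I. word_act w (g i))"
  by (induction I rule: infinite_finite_induct) (simp_all add: word_act_add)

lemma free_act_superset:
  assumes "finite S" "Poly_Mapping.keys x \<subseteq> S"
  shows "free_act x f = (\<Sum>w\<in>S. Polynomial.smult (Poly_Mapping.lookup x w) (word_act w f))"
  unfolding free_act_def using assms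
  by (intro sum.mono_neutral_left) (auto simp: in_keys_iff)

lemma free_act_plus: "free_act (x + y) f = free_act x f + free_act y f"
proof -
  let ?S = "Poly_Mapping.keys x \<union> Poly_Mapping.keys y"
  have S: "finite ?S" by simp
  show ?thesis
    using free_act_superset[OF S, of x f] free_act_superset[OF S, of y f]
      free_act_superset[OF S, of "x + y" f] Poly_Mapping.keys_add[of x y]
    by (simp add: lookup_add smult_add_left sum.distrib)
qed

lemma free_act_diff: "free_act (x - y) f = free_act x f - free_act y f"
  using free_act_plus[of "x - y" y f] by simp

lemma free_act_zero_left [simp]: "free_act 0 f = 0"
  by (simp add: free_act_def)

lemma free_act_zero_right [simp]: "free_act x 0 = 0"
  by (simp add: free_act_def)

lemma free_act_sum: "free_act (\<Sum>i\<in>I. g i) f = (\<Sum>i\<in>I. free_act (g i) f)"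
  by (induction I rule: infinite_finite_induct) (simp_all add: free_act_plus)

lemma free_act_single:
  "free_act (Poly_Mapping.single w c) f = Polynomial.smult c (word_act w f)"
  by (simp add: free_act_def)

lemma free_sum_single:
  "x = (\<Sum>w\<in>Poly_Mapping.keys x. Poly_Mapping.single w (Poly_Mapping.lookup x w))" for x :: "'k::field weyl_free"
  by (rule poly_mapping_eqI)
     (auto simp: lookup_sum lookup_single when_def in_keys_iff)

lemma smult_sum: "Polynomial.smult c (\<Sum>i\<in>I. g i) = (\<Sum>i\<in>I. Polynomial.smult c (g i))"
  by (induction I rule: infinite_finite_induct) (simp_all add: smult_add_right)

lemma free_act_mult: "free_act (x * y) f = free_act x (free_act y f)"
proof -
  have "x * y = (\<Sum>u\<in>Poly_Mapping.keys x. \<Sum>v\<in>Poly_Mapping.keys y.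
      Poly_Mapping.single (u + v) (Poly_Mapping.lookup x u * Poly_Mapping.lookup y v))"
    by (subst (1) free_sum_single[of x], subst (1) free_sum_single[of y])
       (simp only: sum_product mult_single)
  hence "free_act (x * y) f = (\<Sum>u\<in>Poly_Mapping.keys x. \<Sum>v\<in>Poly_Mapping.keys y.
      Polynomial.smult (Poly_Mapping.lookup x u * Poly_Mapping.lookup y v) (word_act (u + v) f))"
    by (simp add: free_act_sum free_act_single)
  also have "\<dots> = free_act x (free_act y f)"
    by (simp add: free_act_def word_act_sum word_act_smult word_act_plus smult_sum)
  finally show ?thesis .
qed

lemma free_act_one: "free_act 1 f = f"
  by (simp add: single_one[symmetric] free_act_single word_act_def zero_weyl_word_def
      del: single_one)

lemma weyl_ideal_act: "x \<in> weyl_ideal \<Longrightarrow> free_act x f = 0"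
proof (induction arbitrary: f rule: weyl_ideal.induct)
  case relator
  show ?case
    by (simp add: free_act_diff free_act_mult free_act_one free_gen_def free_act_single
        word_act_def pderiv_pCons)
qed (simp_all add: free_act_diff free_act_mult)

lemma one_notin_weyl_ideal: "(1 :: 'k::field weyl_free) \<notin> weyl_ideal"
  using weyl_ideal_act[of 1 "1 :: 'k poly"] by (auto simp: free_act_one)

definition weyl_rel :: "'k::field weyl_free \<Rightarrow> 'k weyl_free \<Rightarrow> bool"
  where "weyl_rel x y \<longleftrightarrow> x - y \<in> weyl_ideal"

lemma weyl_rel_equivp: "equivp weyl_rel"
proof (rule equivpI)
  show "reflp weyl_rel" by (simp add: reflp_def weyl_rel_def weyl_ideal.zero)
  show "symp weyl_rel" unfolding symp_def weyl_rel_def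
    using weyl_ideal_uminus by fastforce
  show "transp weyl_rel" unfolding transp_def weyl_rel_def
    using weyl_ideal_add by fastforce
qed

quotient_type (overloaded) 'k weyl = "'k::field weyl_free" / weyl_rel
  by (rule weyl_rel_equivp)

instantiation weyl :: (field) ring_1
begin

lift_definition zero_weyl :: "'a weyl" is 0 .
lift_definition one_weyl :: "'a weyl" is 1 .

lift_definition plus_weyl :: "'a weyl \<Rightarrow> 'a weyl \<Rightarrow> 'a weyl" is "(+)"
  unfolding weyl_rel_def by (metis add_diff_add weyl_ideal_add)

lift_definition minus_weyl :: "'a weyl \<Rightarrow> 'a weyl \<Rightarrow> 'a weyl" is "(-)"
proof -
  fix a b c d :: "'a weyl_free"
  assume "weyl_rel a b" "weyl_rel c d"
  moreover have "(a - c) - (b - d) = (a - b) - (c - d)" by simp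
  ultimately show "weyl_rel (a - c) (b - d)"
    unfolding weyl_rel_def by (metis weyl_ideal.diff)
qed

lift_definition uminus_weyl :: "'a weyl \<Rightarrow> 'a weyl" is uminus
  unfolding weyl_rel_def by (metis minus_diff_minus weyl_ideal_uminus)

lift_definition times_weyl :: "'a weyl \<Rightarrow> 'a weyl \<Rightarrow> 'a weyl" is "(*)"
proof -
  fix a b c d :: "'a weyl_free"
  assume "weyl_rel a b" "weyl_rel c d"
  moreover have "a * c - b * d = (a - b) * c + b * (c - d)" by (simp add: algebra_simps)
  ultimately show "weyl_rel (a * c) (b * d)"
    unfolding weyl_rel_def
    by (metis weyl_ideal_add weyl_ideal.mult_left weyl_ideal.mult_right)
qed

instance
proof
  fix a b c :: "'a weyl"
  show "a * b * c = a * (b * c)"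
    by transfer (simp add: weyl_rel_def weyl_ideal.zero mult.assoc)
  show "a + b + c = a + (b + c)"
    by transfer (simp add: weyl_rel_def weyl_ideal.zero add.assoc)
  show "a + b = b + a"
    by transfer (simp add: weyl_rel_def weyl_ideal.zero add.commute)
  show "0 + a = a" by transfer (simp add: weyl_rel_def weyl_ideal.zero)
  show "- a + a = 0" by transfer (simp add: weyl_rel_def weyl_ideal.zero)
  show "a - b = a + - b" by transfer (simp add: weyl_rel_def weyl_ideal.zero)
  show "(a + b) * c = a * c + b * c"
    by transfer (simp add: weyl_rel_def weyl_ideal.zero algebra_simps)
  show "a * (b + c) = a * b + a * c"
    by transfer (simp add: weyl_rel_def weyl_ideal.zero algebra_simps)
  show "1 * a = a" by transfer (simp add: weyl_rel_def weyl_ideal.zero)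
  show "a * 1 = a" by transfer (simp add: weyl_rel_def weyl_ideal.zero)
  show "(0 :: 'a weyl) \<noteq> 1"
    by transfer (use weyl_ideal_uminus one_notin_weyl_ideal in \<open>fastforce simp: weyl_rel_def\<close>)
qed

end

lift_definition weyl_p :: "'k::field weyl" is "free_gen Gen_p" .
lift_definition weyl_q :: "'k::field weyl" is "free_gen Gen_q" .

lemma weyl_relation: "weyl_q * weyl_p - weyl_p * weyl_q = (1 :: 'k::field weyl)"
  by transfer (simp add: weyl_rel_def weyl_ideal.relator)

lift_definition weyl_scale :: "'k::field \<Rightarrow> 'k weyl \<Rightarrow> 'k weyl"
  is "\<lambda>c x. Poly_Mapping.single 0 c * x"
  unfolding weyl_rel_def by (metis right_diff_distrib weyl_ideal.mult_left)

section \<open>Algebras, bimodules and Hochschild cohomology\<close>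

locale assoc_algebra = vector_space scaleA
  for scaleA :: "'k::field \<Rightarrow> 'a::ring \<Rightarrow> 'a" +
  assumes scale_mult_left: "scaleA c a * b = scaleA c (a * b)"
    and scale_mult_right: "a * scaleA c b = scaleA c (a * b)"

lemma single_zero_central:
  "Poly_Mapping.single 0 c * x = x * Poly_Mapping.single 0 c" for x :: "'k::field weyl_free"
proof -
  have "Poly_Mapping.single 0 c * (\<Sum>w\<in>Poly_Mapping.keys x. Poly_Mapping.single w (Poly_Mapping.lookup x w))
      = (\<Sum>w\<in>Poly_Mapping.keys x. Poly_Mapping.single w (Poly_Mapping.lookup x w)) * Poly_Mapping.single 0 c"
    by (simp add: sum_distrib_left sum_distrib_right mult_single mult.commute)
  thus ?thesis by (simp only: free_sum_single[symmetric])
qed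

interpretation weyl: assoc_algebra "weyl_scale :: 'k::field \<Rightarrow> _"
proof
  fix a b :: 'k and x y :: "'k weyl"
  show "weyl_scale a (x + y) = weyl_scale a x + weyl_scale a y"
    by transfer (simp add: weyl_rel_def weyl_ideal.zero algebra_simps)
  show "weyl_scale (a + b) x = weyl_scale a x + weyl_scale b x"
    by transfer (simp add: weyl_rel_def weyl_ideal.zero single_add algebra_simps)
  show "weyl_scale a (weyl_scale b x) = weyl_scale (a * b) x"
    by transfer (simp add: weyl_rel_def weyl_ideal.zero mult_single mult.assoc[symmetric])
  show "weyl_scale 1 x = x"
    by transfer (simp add: weyl_rel_def weyl_ideal.zero)
  show "weyl_scale a x * y = weyl_scale a (x * y)"
    by transfer (simp add: weyl_rel_def weyl_ideal.zero mult.assoc)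
  show "x * weyl_scale a y = weyl_scale a (x * y)"
    by transfer (metis weyl_rel_def diff_self weyl_ideal.zero mult.assoc single_zero_central)
qed

text \<open>No unit of the algebra is assumed, and a unit, if there is one, need not act as the
  identity on either side.\<close>

locale bimodule =
  A: assoc_algebra scaleA + M: vector_space scaleM
  for scaleA :: "'k::field \<Rightarrow> 'a::ring \<Rightarrow> 'a"
    and scaleM :: "'k \<Rightarrow> 'm::ab_group_add \<Rightarrow> 'm" +
  fixes lact :: "'a \<Rightarrow> 'm \<Rightarrow> 'm"
    and ract :: "'m \<Rightarrow> 'a \<Rightarrow> 'm"
  assumes lact_linear: "Vector_Spaces.linear scaleM scaleM (\<lambda>m. lact a m)"
    and lact_linear_alg: "Vector_Spaces.linear scaleA scaleM (\<lambda>a. lact a m)"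
    and ract_linear: "Vector_Spaces.linear scaleM scaleM (\<lambda>m. ract m a)"
    and ract_linear_alg: "Vector_Spaces.linear scaleA scaleM (\<lambda>a. ract m a)"
    and lact_assoc: "lact (a * b) m = lact a (lact b m)"
    and ract_assoc: "ract m (a * b) = ract (ract m a) b"
    and lact_ract_commute: "ract (lact a m) b = lact a (ract m b)"
begin

text \<open>The space of linear maps from the \<open>n\<close>-fold tensor power of the algebra to the bimodule,
  as \<open>n\<close>-linear functions of argument lists. They are set to zero on lists of any other length,
  so that equality of cochains is equality of functions.\<close>

definition cochains :: "nat \<Rightarrow> ('a list \<Rightarrow> 'm) set" where
  "cochains n = {f. (\<forall>xs. length xs \<noteq> n \<longrightarrow> f xs = 0) \<and>
     (\<forall>xs ys. length xs + 1 + length ys = n \<longrightarrow>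
        Vector_Spaces.linear scaleA scaleM (\<lambda>a. f (xs @ [a] @ ys)))}"

text \<open>Positions in lists count from 0, so the argument written \<open>a\<^sub>i\<close> in the usual formula
  is \<open>as ! (i - 1)\<close>.\<close>

definition differential :: "nat \<Rightarrow> ('a list \<Rightarrow> 'm) \<Rightarrow> 'a list \<Rightarrow> 'm" where
  "differential n f as = (if length as \<noteq> n + 1 then 0 else
     lact (as ! 0) (f (drop 1 as))
     + (\<Sum>i=1..n. scaleM ((-1) ^ i)
          (f (take (i - 1) as @ [as ! (i - 1) * as ! i] @ drop (i + 1) as)))
     + scaleM ((-1) ^ (n + 1)) (ract (f (take n as)) (as ! n)))"

definition cocycles :: "nat \<Rightarrow> ('a list \<Rightarrow> 'm) set" where
  "cocycles n = {f \<in> cochains n. differential n f = (\<lambda>_. 0)}"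

definition coboundaries :: "nat \<Rightarrow> ('a list \<Rightarrow> 'm) set" where
  "coboundaries n = (case n of 0 \<Rightarrow> {\<lambda>_. 0} | Suc k \<Rightarrow> differential k ` cochains k)"

definition cocycle_group :: "nat \<Rightarrow> ('a list \<Rightarrow> 'm) monoid" where
  "cocycle_group n = \<lparr>carrier = cocycles n, mult = (\<lambda>f g as. f as + g as), one = (\<lambda>_. 0)\<rparr>"

definition cohomology :: "nat \<Rightarrow> ('a list \<Rightarrow> 'm) set monoid" where
  "cohomology n = cocycle_group n Mod coboundaries n"

end

end

theory Submission
  imports Defs
begin

text \<open>Let \<open>f\<close> be a 3-cocycle. Non-unitality of the left action and the values of \<open>f\<close> with a unit in
  one of the first two places are removed by explicit coboundaries. A 2-cochain \<open>g\<close> with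
  \<open>\<Delta>g = f\<close> is then built along the basis \<open>p\<^sup>iq\<^sup>j\<close> in the first argument. The only constraint
  comes from the relation \<open>qp = pq + 1\<close>, and it is met by prescribing \<open>g(q, -)\<close> through a
  recursion on \<open>i\<close>. Since \<open>qp\<close> does not overlap with itself, no further constraint appears:
  \<open>f - \<Delta>g\<close> vanishes on \<open>(p, -, -)\<close>, \<open>(q, p, -)\<close> and \<open>(q, q\<^sup>j, -)\<close>, and the cocycle identity
  forces it to vanish everywhere.\<close>


section \<open>The monomial basis of the Weyl algebra\<close>

lemma weyl_qp: "weyl_q * weyl_p = weyl_p * weyl_q + (1 :: 'k::field weyl)"
  using weyl_relation by (simp add: diff_eq_eq add.commute)

text \<open>Classes of words span the quotient, and each word arises from the empty one by left
  multiplication with generators.\<close>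

lemma weyl_induct [case_names one p q add scale]:
  fixes x :: "'k::field weyl"
  assumes one: "P 1"
    and p: "\<And>x. P x \<Longrightarrow> P (weyl_p * x)"
    and q: "\<And>x. P x \<Longrightarrow> P (weyl_q * x)"
    and add: "\<And>x y. P x \<Longrightarrow> P y \<Longrightarrow> P (x + y)"
    and scale: "\<And>c x. P x \<Longrightarrow> P (weyl_scale c x)"
  shows "P x"
proof -
  have word: "P (abs_weyl (Poly_Mapping.single (Word l) 1))" for l
  proof (induction l)
    case Nil
    have "Poly_Mapping.single (Word []) (1 :: 'k) = 1"
      by (simp flip: zero_weyl_word_def)
    then show ?case
      using one by (simp add: one_weyl_def)
  next
    case (Cons g l)
    have "Poly_Mapping.single (Word (g # l)) (1 :: 'k) = free_gen g * Poly_Mapping.single (Word l) 1"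
      by (simp add: free_gen_def mult_single plus_weyl_word_def)
    then have "abs_weyl (Poly_Mapping.single (Word (g # l)) 1)
        = abs_weyl (free_gen g) * abs_weyl (Poly_Mapping.single (Word l) (1 :: 'k))"
      by (simp add: times_weyl.abs_eq)
    then show ?case
      using p[OF Cons.IH] q[OF Cons.IH] by (cases g) (simp_all add: weyl_p_def weyl_q_def)
  qed
  have single: "P (abs_weyl (Poly_Mapping.single w c))" for w and c :: 'k
  proof -
    have "Poly_Mapping.single w c = Poly_Mapping.single 0 c * Poly_Mapping.single w 1"
      by (simp add: mult_single)
    then have "abs_weyl (Poly_Mapping.single w c) = weyl_scale c (abs_weyl (Poly_Mapping.single w 1))"
      by (simp add: weyl_scale.abs_eq)
    then show ?thesis
      using word[of "letters w"] scale by simp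
  qed
  have sum: "P (abs_weyl (\<Sum>w\<in>S. Poly_Mapping.single w (c w)))" if "finite S" for S and c :: "weyl_word \<Rightarrow> 'k"
    using that
  proof (induction S)
    case empty
    then show ?case
      using scale[OF one, of 0] by (simp add: zero_weyl_def)
  next
    case (insert w S)
    then show ?case
      using add[OF single] by (simp flip: plus_weyl.abs_eq)
  qed
  obtain y where "x = abs_weyl y"
    by (metis Quotient_weyl Quotient_def)
  then show ?thesis
    using sum[of "Poly_Mapping.keys y" "Poly_Mapping.lookup y"] free_sum_single[of y] by simp
qed

definition weyl_monom :: "nat \<Rightarrow> nat \<Rightarrow> 'k::field weyl"
  where "weyl_monom i j = weyl_p ^ i * weyl_q ^ j"

lemma weyl_monom_0_0: "weyl_monom 0 0 = 1"
  by (simp add: weyl_monom_def)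

lemma p_times_weyl_monom: "weyl_p * weyl_monom i j = weyl_monom (Suc i) j"
  by (simp add: weyl_monom_def mult.assoc)

lemma q_times_weyl_monom_0: "weyl_q * weyl_monom 0 j = weyl_monom 0 (Suc j)"
  by (simp add: weyl_monom_def)

lemma q_times_weyl_monom_Suc:
  "weyl_q * weyl_monom (Suc i) j = weyl_p * (weyl_q * weyl_monom i j) + weyl_monom i j"
proof -
  have "weyl_q * weyl_monom (Suc i) j = (weyl_q * weyl_p) * weyl_monom i j"
    by (simp flip: p_times_weyl_monom add: mult.assoc)
  then show ?thesis
    by (simp add: weyl_qp algebra_simps)
qed

text \<open>The span of the monomials contains 1 and is stable under left multiplication by
  \<open>weyl_p\<close> and \<open>weyl_q\<close>, so it is everything. Stability under
  \<open>weyl_q\<close> is an induction on the power of \<open>p\<close>, moving \<open>q\<close>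
  past one \<open>p\<close> at a time.\<close>

lemma weyl_monom_induct [case_names monom add scale]:
  fixes x :: "'k::field weyl"
  assumes monom: "\<And>i j. P (weyl_monom i j)"
    and add: "\<And>x y. P x \<Longrightarrow> P y \<Longrightarrow> P (x + y)"
    and scale: "\<And>c x. P x \<Longrightarrow> P (weyl_scale c x)"
  shows "P x"
proof -
  let ?B = "range (\<lambda>(i, j). weyl_monom i j) :: 'k weyl set"
  have monom_span: "weyl_monom i j \<in> weyl.span ?B" for i j
    by (rule weyl.span_base) force
  have p_span: "weyl_p * x \<in> weyl.span ?B" if "x \<in> weyl.span ?B" for x
    using that
  proof (induction rule: weyl.span_induct_alt)
    case base
    then show ?case by (simp add: weyl.span_zero)
  next
    case (step c x y)
    then show ?case
      by (auto simp: distrib_left weyl.scale_mult_right p_times_weyl_monom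
          intro!: weyl.span_add weyl.span_scale monom_span)
  qed
  have q_monom: "weyl_q * weyl_monom i j \<in> weyl.span ?B" for i j
    by (induction i)
      (auto simp: q_times_weyl_monom_0 q_times_weyl_monom_Suc intro!: weyl.span_add p_span monom_span)
  have q_span: "weyl_q * x \<in> weyl.span ?B" if "x \<in> weyl.span ?B" for x
    using that
  proof (induction rule: weyl.span_induct_alt)
    case base
    then show ?case by (simp add: weyl.span_zero)
  next
    case (step c x y)
    then show ?case
      by (auto simp: distrib_left weyl.scale_mult_right
          intro!: weyl.span_add weyl.span_scale q_monom)
  qed
  have "x \<in> weyl.span ?B"
    by (induction x rule: weyl_induct)
      (use monom_span[of 0 0] in \<open>auto simp: weyl_monom_0_0
        intro: p_span q_span weyl.span_add weyl.span_scale\<close>)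
  then show ?thesis
  proof (induction rule: weyl.span_induct_alt)
    case base
    then show ?case using scale[OF monom, of 0] by simp
  next
    case (step c x y)
    then show ?case by (auto intro!: add scale monom)
  qed
qed

section \<open>The polynomial representation and linear independence of the monomials\<close>

lift_definition weyl_act :: "'k::field weyl \<Rightarrow> 'k poly \<Rightarrow> 'k poly" is free_act
proof (rule ext)
  fix x y :: "'k weyl_free" and f :: "'k poly"
  assume "weyl_rel x y"
  then have "free_act (x - y) f = 0"
    unfolding weyl_rel_def by (rule weyl_ideal_act)
  then show "free_act x f = free_act y f"
    by (simp add: free_act_diff)
qed

lemma weyl_act_zero: "weyl_act 0 f = 0"
  by transfer simp

lemma weyl_act_one: "weyl_act 1 f = f"
  by transfer (rule free_act_one)

lemma weyl_act_add: "weyl_act (x + y) f = weyl_act x f + weyl_act y f"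
  by transfer (rule free_act_plus)

lemma weyl_act_mult: "weyl_act (x * y) f = weyl_act x (weyl_act y f)"
  by transfer (rule free_act_mult)

lemma weyl_act_scale: "weyl_act (weyl_scale c x) f = Polynomial.smult c (weyl_act x f)"
  by transfer (simp add: free_act_mult free_act_single word_act_def zero_weyl_word_def)

lemma weyl_act_sum: "weyl_act (\<Sum>i\<in>I. x i) f = (\<Sum>i\<in>I. weyl_act (x i) f)"
  by (induction I rule: infinite_finite_induct) (simp_all add: weyl_act_add weyl_act_zero)

lemma weyl_act_p: "weyl_act weyl_p f = pCons 0 f"
  by transfer (simp add: free_gen_def free_act_single word_act_def)

lemma weyl_act_q: "weyl_act weyl_q f = pderiv f"
  by transfer (simp add: free_gen_def free_act_single word_act_def)

lemma weyl_act_monom: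
  fixes f :: "'k::field poly"
  shows "weyl_act (weyl_monom i j) f = Polynomial.monom 1 i * (pderiv ^^ j) f"
proof -
  have "weyl_act (weyl_p ^ i) f = Polynomial.monom 1 i * f" for f :: "'k poly"
    by (induction i) (simp_all add: weyl_act_one weyl_act_mult weyl_act_p monom_0 monom_Suc)
  moreover have "weyl_act (weyl_q ^ j) f = (pderiv ^^ j) f"
    by (induction j) (simp_all add: weyl_act_one weyl_act_mult weyl_act_q)
  ultimately show ?thesis
    by (simp add: weyl_monom_def weyl_act_mult)
qed

lemma weyl_monom_lin_indep:
  fixes c :: "nat \<times> nat \<Rightarrow> 'k::field_char_0"
  assumes S: "finite S" and sum: "(\<Sum>(i, j)\<in>S. weyl_scale (c (i, j)) (weyl_monom i j)) = 0"
  shows "\<forall>s\<in>S. c s = 0"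
proof (rule ccontr)
  assume "\<not> (\<forall>s\<in>S. c s = 0)"
  then have ex: "\<exists>n i. (i, n) \<in> S \<and> c (i, n) \<noteq> 0" by auto
  \<comment> \<open>Apply the relation to \<open>x\<^sup>n\<close>, where \<open>n\<close> is the least power of \<open>q\<close> that occurs.\<close>
  define n where "n = (LEAST n. \<exists>i. (i, n) \<in> S \<and> c (i, n) \<noteq> 0)"
  obtain m where m: "(m, n) \<in> S" "c (m, n) \<noteq> 0"
    using LeastI_ex[OF ex] unfolding n_def by blast
  have minimal: "c (i, j) = 0" if "(i, j) \<in> S" "j < n" for i j
    using not_less_Least[of j "\<lambda>n. \<exists>i. (i, n) \<in> S \<and> c (i, n) \<noteq> 0"] that unfolding n_def by blast
  have deriv: "(pderiv ^^ j) (Polynomial.monom (1 :: 'k) n) = (if j = n then [:fact n:] else 0)" if "n \<le> j" for j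
    using that
    by (intro poly_eqI) (auto simp: coeff_higher_pderiv coeff_pCons pochhammer_fact split: nat.splits)
  have "0 = weyl_act (\<Sum>(i, j)\<in>S. weyl_scale (c (i, j)) (weyl_monom i j)) (Polynomial.monom 1 n)"
    by (simp add: sum weyl_act_zero)
  also have "\<dots> = (\<Sum>s\<in>S. Polynomial.smult (c s)
      (Polynomial.monom 1 (fst s) * (pderiv ^^ snd s) (Polynomial.monom 1 n)))"
    by (simp add: weyl_act_sum weyl_act_scale weyl_act_monom case_prod_unfold)
  also have "\<dots> = (\<Sum>s\<in>S. if snd s = n then Polynomial.monom (c s * fact n) (fst s) else 0)"
  proof (rule sum.cong)
    fix s assume s: "s \<in> S"
    show "Polynomial.smult (c s) (Polynomial.monom 1 (fst s) * (pderiv ^^ snd s) (Polynomial.monom 1 n))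
        = (if snd s = n then Polynomial.monom (c s * fact n) (fst s) else 0)"
    proof (cases "snd s < n")
      case True
      then show ?thesis using minimal[of "fst s" "snd s"] s by simp
    next
      case False
      then show ?thesis by (simp add: deriv smult_monom mult.commute)
    qed
  qed simp
  finally have "0 = Polynomial.coeff (\<Sum>s\<in>S. if snd s = n then Polynomial.monom (c s * fact n) (fst s) else 0) m"
    by simp
  also have "\<dots> = (\<Sum>s\<in>S. if s = (m, n) then c s * fact n else 0)"
    unfolding coeff_sum by (intro sum.cong) auto
  also have "\<dots> = c (m, n) * fact n"
    using S m by simp
  \<comment> \<open>Characteristic zero enters here: \<open>fact n\<close> is nonzero.\<close>
  finally show False using m by simp
qed

text \<open>Two coinciding monomials would satisfy a relation with coefficients 1 and -1.
  Injectivity turns independence of the indexed family into independence of its range.\<close>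

lemma inj_weyl_monom: "inj (\<lambda>(i, j). weyl_monom i j :: 'k::field_char_0 weyl)"
proof (rule injI, rule ccontr)
  fix s t :: "nat \<times> nat"
  assume eq: "(\<lambda>(i, j). weyl_monom i j :: 'k weyl) s = (\<lambda>(i, j). weyl_monom i j) t"
    and "s \<noteq> t"
  then have "(\<Sum>(i, j)\<in>{s, t}. weyl_scale (if (i, j) = s then 1 else - 1) (weyl_monom i j :: 'k weyl)) = 0"
    by (auto simp: case_prod_unfold)
  then show False
    using weyl_monom_lin_indep[of "{s, t}" "\<lambda>u. if u = s then 1 else - 1 :: 'k"] by simp
qed

lemma independent_weyl_monom:
  "\<not> weyl.dependent (range (\<lambda>(i, j). weyl_monom i j) :: 'k::field_char_0 weyl set)"
  unfolding weyl.independent_explicit_finite_subsets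
proof (intro allI impI ballI)
  fix S u and v :: "'k weyl"
  let ?m = "\<lambda>(i, j). weyl_monom i j :: 'k weyl"
  assume S: "S \<subseteq> range ?m" "finite S" and sum: "(\<Sum>v\<in>S. weyl_scale (u v) v) = 0" and v: "v \<in> S"
  obtain T where T: "finite T" "S = ?m ` T"
    using finite_subset_image[OF S(2,1)] by blast
  have "(\<Sum>v\<in>S. weyl_scale (u v) v) = (\<Sum>s\<in>T. weyl_scale (u (?m s)) (?m s))"
    unfolding T(2) using inj_weyl_monom by (subst sum.reindex) (auto intro: inj_on_subset)
  then have "\<forall>s\<in>T. u (?m s) = 0"
    using weyl_monom_lin_indep[of T "\<lambda>s. u (?m s)"] sum T(1) by (simp add: case_prod_unfold)
  then show "u v = 0" using v T(2) by auto
qed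

text \<open>Linear maps can be prescribed freely on an independent set. The maps from which the
  2-cochain \<open>g\<close> is built come from this.\<close>

lemma ex_linear_on_weyl_monom:
  fixes scaleM :: "'k::field_char_0 \<Rightarrow> 'm::ab_group_add \<Rightarrow> 'm"
  assumes "vector_space scaleM"
  shows "\<exists>u. Vector_Spaces.linear weyl_scale scaleM u \<and> (\<forall>i j. u (weyl_monom i j) = v i j)"
proof -
  interpret vector_space_pair weyl_scale scaleM
    using assms weyl.vector_space_axioms by (simp add: vector_space_pair_def)
  let ?m = "\<lambda>(i, j). weyl_monom i j :: 'k weyl"
  let ?u = "construct (range ?m) (\<lambda>x. case inv_into UNIV ?m x of (i, j) \<Rightarrow> v i j)"
  have "?u (weyl_monom i j) = v i j" for i j
  proof -
    have "weyl_monom i j \<in> range ?m" by force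
    moreover have "inv_into UNIV ?m (weyl_monom i j) = (i, j)"
      using inv_f_f[OF inj_weyl_monom, of "(i, j)"] by simp
    ultimately show ?thesis
      using construct_basis[OF independent_weyl_monom] by simp
  qed
  then show ?thesis
    using linear_construct[OF independent_weyl_monom] by blast
qed

section \<open>Cochains of low degree as multilinear functions\<close>

context bimodule
begin

lemma lact_add_right: "lact a (m + n) = lact a m + lact a n"
  and lact_scale_right: "lact a (scaleM c m) = scaleM c (lact a m)"
  using lact_linear[of a] by (simp_all add: Vector_Spaces.linear_iff)

lemma lact_add_left: "lact (a + b) m = lact a m + lact b m"
  and lact_scale_left: "lact (scaleA c a) m = scaleM c (lact a m)"
  using lact_linear_alg[of m] by (simp_all add: Vector_Spaces.linear_iff)

lemma ract_add_left: "ract (m + n) a = ract m a + ract n a"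
  and ract_scale_left: "ract (scaleM c m) a = scaleM c (ract m a)"
  using ract_linear[of a] by (simp_all add: Vector_Spaces.linear_iff)

lemma ract_add_right: "ract m (a + b) = ract m a + ract m b"
  and ract_scale_right: "ract m (scaleA c a) = scaleM c (ract m a)"
  using ract_linear_alg[of m] by (simp_all add: Vector_Spaces.linear_iff)

lemma lact_zero_right: "lact a 0 = 0"
  using lact_add_right[of a 0 0] by simp

lemma ract_zero_left: "ract 0 a = 0"
  using ract_add_left[of 0 0 a] by simp

lemma lact_minus_right: "lact a (- m) = - lact a m"
  using lact_add_right[of a m "- m"] by (simp add: lact_zero_right eq_neg_iff_add_eq_0 add.commute)

lemma ract_minus_left: "ract (- m) a = - ract m a"
  using ract_add_left[of m "- m" a] by (simp add: ract_zero_left eq_neg_iff_add_eq_0 add.commute)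

lemma lact_diff_right: "lact a (m - n) = lact a m - lact a n"
  using lact_add_right[of a m "- n"] by (simp add: lact_minus_right)

lemma ract_diff_left: "ract (m - n) a = ract m a - ract n a"
  using ract_add_left[of m "- n" a] by (simp add: ract_minus_left)

lemmas act_simps =
  lact_add_right lact_scale_right lact_add_left lact_scale_left lact_zero_right lact_minus_right
  lact_diff_right ract_add_left ract_scale_left ract_add_right ract_scale_right ract_zero_left
  ract_minus_left ract_diff_left M.scale_right_distrib M.scale_right_diff_distrib M.scale_minus_right

text \<open>Explicit equations, and separate arguments in place of lists, let the simplifier settle
  (multi)linearity and cocycle computations; \<open>linear_iff_lin\<close> links back to the library
  notion.\<close>

definition lin :: "('a \<Rightarrow> 'm) \<Rightarrow> bool"
  where "lin f \<longleftrightarrow> (\<forall>a b. f (a + b) = f a + f b) \<and> (\<forall>c a. f (scaleA c a) = scaleM c (f a))"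

definition bilin :: "('a \<Rightarrow> 'a \<Rightarrow> 'm) \<Rightarrow> bool"
  where "bilin g \<longleftrightarrow> (\<forall>b. lin (\<lambda>a. g a b)) \<and> (\<forall>a. lin (\<lambda>b. g a b))"

definition trilin :: "('a \<Rightarrow> 'a \<Rightarrow> 'a \<Rightarrow> 'm) \<Rightarrow> bool"
  where "trilin f \<longleftrightarrow> (\<forall>b c. lin (\<lambda>a. f a b c)) \<and> (\<forall>a c. lin (\<lambda>b. f a b c)) \<and> (\<forall>a b. lin (\<lambda>c. f a b c))"

definition diff2 :: "('a \<Rightarrow> 'a \<Rightarrow> 'm) \<Rightarrow> 'a \<Rightarrow> 'a \<Rightarrow> 'a \<Rightarrow> 'm"
  where "diff2 g a b c = lact a (g b c) - g (a * b) c + g a (b * c) - ract (g a b) c"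

definition diff3 :: "('a \<Rightarrow> 'a \<Rightarrow> 'a \<Rightarrow> 'm) \<Rightarrow> 'a \<Rightarrow> 'a \<Rightarrow> 'a \<Rightarrow> 'a \<Rightarrow> 'm"
  where "diff3 f a b c d =
    lact a (f b c d) - f (a * b) c d + f a (b * c) d - f a b (c * d) + ract (f a b c) d"

definition cocycle3 :: "('a \<Rightarrow> 'a \<Rightarrow> 'a \<Rightarrow> 'm) \<Rightarrow> bool"
  where "cocycle3 f \<longleftrightarrow> trilin f \<and> (\<forall>a b c d. diff3 f a b c d = 0)"

definition exact3 :: "('a \<Rightarrow> 'a \<Rightarrow> 'a \<Rightarrow> 'm) \<Rightarrow> bool"
  where "exact3 f \<longleftrightarrow> (\<exists>g. bilin g \<and> (\<forall>a b c. f a b c = diff2 g a b c))"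

lemma linear_iff_lin: "Vector_Spaces.linear scaleA scaleM f \<longleftrightarrow> lin f"
  using A.vector_space_axioms M.vector_space_axioms by (simp add: Vector_Spaces.linear_iff lin_def)

lemma bilin_add: "bilin g \<Longrightarrow> bilin h \<Longrightarrow> bilin (\<lambda>a b. g a b + h a b)"
  by (simp add: bilin_def lin_def act_simps)

lemma diff2_add: "diff2 (\<lambda>a b. g a b + h a b) a b c = diff2 g a b c + diff2 h a b c"
  by (simp add: diff2_def act_simps)

lemma trilin_diff2: "bilin g \<Longrightarrow> trilin (diff2 g)"
  by (simp add: bilin_def trilin_def lin_def diff2_def act_simps A.scale_mult_left A.scale_mult_right
      distrib_left distrib_right)

lemma diff3_diff2: "bilin g \<Longrightarrow> diff3 (diff2 g) a b c d = 0"
  by (simp add: diff3_def diff2_def act_simps lact_assoc ract_assoc lact_ract_commute mult.assoc)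

lemma cocycle3_diff2: "bilin g \<Longrightarrow> cocycle3 (diff2 g)"
  by (simp add: cocycle3_def trilin_diff2 diff3_diff2)

lemma diff3_add:
  "diff3 (\<lambda>a b c. f a b c + g a b c) a b c d = diff3 f a b c d + diff3 g a b c d"
  by (simp add: diff3_def act_simps)

lemma diff3_uminus: "diff3 (\<lambda>a b c. - f a b c) a b c d = - diff3 f a b c d"
  by (simp add: diff3_def act_simps)

lemma cocycle3_add: "cocycle3 f \<Longrightarrow> cocycle3 g \<Longrightarrow> cocycle3 (\<lambda>a b c. f a b c + g a b c)"
  by (simp add: cocycle3_def diff3_add) (simp add: trilin_def lin_def act_simps)

lemma cocycle3_uminus: "cocycle3 f \<Longrightarrow> cocycle3 (\<lambda>a b c. - f a b c)"
  by (simp add: cocycle3_def diff3_uminus) (simp add: trilin_def lin_def act_simps)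

lemma cocycle3_diff: "cocycle3 f \<Longrightarrow> cocycle3 g \<Longrightarrow> cocycle3 (\<lambda>a b c. f a b c - g a b c)"
  using cocycle3_add[of f "\<lambda>a b c. - g a b c"] cocycle3_uminus[of g] by simp

section \<open>Comparison with cochains on lists\<close>

lemma cochains_2_iff:
  "f \<in> cochains 2 \<longleftrightarrow> (\<forall>as. length as \<noteq> 2 \<longrightarrow> f as = 0) \<and> bilin (\<lambda>a b. f [a, b])"
proof -
  have *: "length xs + 1 + length ys = 2 \<longleftrightarrow> (\<exists>b. xs = [] \<and> ys = [b]) \<or> (\<exists>a. xs = [a] \<and> ys = [])"
    for xs ys :: "'a list"
    by (cases xs; cases ys) auto
  have "(\<forall>xs ys. length xs + 1 + length ys = 2 \<longrightarrow> P xs ys) \<longleftrightarrow> (\<forall>b. P [] [b]) \<and> (\<forall>a. P [a] [])"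
    for P :: "'a list \<Rightarrow> 'a list \<Rightarrow> bool"
    unfolding * by blast
  then show ?thesis
    by (simp add: cochains_def bilin_def linear_iff_lin)
qed

lemma cochains_3_iff:
  "f \<in> cochains 3 \<longleftrightarrow> (\<forall>as. length as \<noteq> 3 \<longrightarrow> f as = 0) \<and> trilin (\<lambda>a b c. f [a, b, c])"
proof -
  have "(\<forall>xs ys. length xs + 1 + length ys = 3 \<longrightarrow> P xs ys) \<longleftrightarrow>
      (\<forall>b c. P [] [b, c]) \<and> (\<forall>a c. P [a] [c]) \<and> (\<forall>a b. P [a, b] [])" (is "?L \<longleftrightarrow> ?R")
    for P :: "'a list \<Rightarrow> 'a list \<Rightarrow> bool"
  proof
    assume L: ?L
    show ?R
    proof (intro conjI allI)
      show "P [] [b, c]" for b c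
        by (rule L[rule_format]) simp
      show "P [a] [c]" for a c
        by (rule L[rule_format]) simp
      show "P [a, b] []" for a b
        by (rule L[rule_format]) simp
    qed
  next
    assume R: ?R
    \<comment> \<open>The rule \<open>remdups_adj.cases\<close> serves only to split a list into
      empty, singleton, or at least two entries.\<close>
    have "P xs ys" if "length xs + 1 + length ys = 3" for xs ys
      using R that by (cases xs rule: remdups_adj.cases; cases ys rule: remdups_adj.cases) simp_all
    then show ?L by blast
  qed
  then show ?thesis
    by (simp add: cochains_def trilin_def linear_iff_lin)
qed

lemma differential_2: "differential 2 f [a, b, c] = diff2 (\<lambda>a b. f [a, b]) a b c"
  by (simp add: differential_def diff2_def numeral_2_eq_2 algebra_simps)

lemma differential_3: "differential 3 f [a, b, c, d] = diff3 (\<lambda>a b c. f [a, b, c]) a b c d"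
  by (simp add: differential_def diff3_def numeral_3_eq_3 algebra_simps)

lemma length_3_conv: "length as = 3 \<longleftrightarrow> (\<exists>a b c. as = [a, b, c])"
  by (auto simp: numeral_3_eq_3 length_Suc_conv)

lemma cocycles_3_iff:
  "f \<in> cocycles 3 \<longleftrightarrow> (\<forall>as. length as \<noteq> 3 \<longrightarrow> f as = 0) \<and> cocycle3 (\<lambda>a b c. f [a, b, c])"
proof -
  have "differential 3 f = (\<lambda>_. 0) \<longleftrightarrow> (\<forall>a b c d. differential 3 f [a, b, c, d] = 0)"
  proof (intro iffI ext)
    fix as assume *: "\<forall>a b c d. differential 3 f [a, b, c, d] = 0"
    show "differential 3 f as = 0"
    proof (cases "length as = 4")
      case True
      then obtain a b c d where "as = [a, b, c, d]"
        by (auto simp: eval_nat_numeral length_Suc_conv)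
      then show ?thesis using * by simp
    qed (simp add: differential_def)
  qed simp
  then show ?thesis
    by (auto simp: cocycles_def cochains_3_iff cocycle3_def differential_3)
qed

lemma coboundaries_3_iff:
  "f \<in> coboundaries 3 \<longleftrightarrow>
    (\<forall>as. length as \<noteq> 3 \<longrightarrow> f as = 0) \<and> exact3 (\<lambda>a b c. f [a, b, c])"
proof
  assume "f \<in> coboundaries 3"
  then obtain g where "g \<in> cochains 2" and f: "f = differential 2 g"
    by (auto simp: coboundaries_def numeral_3_eq_3 numeral_2_eq_2)
  then show "(\<forall>as. length as \<noteq> 3 \<longrightarrow> f as = 0) \<and>
      exact3 (\<lambda>a b c. f [a, b, c])"
    by (auto simp: cochains_2_iff differential_2 exact3_def) (simp add: differential_def)
next
  assume "(\<forall>as. length as \<noteq> 3 \<longrightarrow> f as = 0) \<and>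
      exact3 (\<lambda>a b c. f [a, b, c])"
  then obtain g where f: "\<And>as. length as \<noteq> 3 \<Longrightarrow> f as = 0" "\<And>a b c. f [a, b, c] = diff2 g a b c"
    and g: "bilin g"
    unfolding exact3_def by blast
  \<comment> \<open>Extension by zero to lists of other lengths, as \<open>cochains\<close>
    demands.\<close>
  define h where "h = (\<lambda>as. if length as = 2 then g (as ! 0) (as ! 1) else 0)"
  have h: "h [a, b] = g a b" for a b
    by (simp add: h_def)
  have "h \<in> cochains 2"
    using g by (simp add: cochains_2_iff h) (simp add: h_def)
  moreover have "f = differential 2 h"
  proof
    fix as show "f as = differential 2 h as"
    proof (cases "length as = 3")
      case True
      then show ?thesis by (auto simp: length_3_conv f differential_2 h)
    qed (simp add: f differential_def)
  qed
  ultimately show "f \<in> coboundaries 3"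
    by (auto simp: coboundaries_def numeral_3_eq_3 numeral_2_eq_2)
qed

text \<open>Needed because \<open>trivial_group\<close> asks for the quotient to be a group, not
  merely for a one-element carrier.\<close>

lemma group_cocycle_group_3: "group (cocycle_group 3)"
proof (rule groupI)
  have zero: "(\<lambda>_. 0) \<in> cocycles 3"
    by (auto simp: cocycles_3_iff cocycle3_def trilin_def lin_def diff3_def act_simps)
  then show "\<one>\<^bsub>cocycle_group 3\<^esub> \<in> carrier (cocycle_group 3)"
    by (simp add: cocycle_group_def)
  fix f assume "f \<in> carrier (cocycle_group 3)"
  then have "(\<lambda>as. - f as) \<in> carrier (cocycle_group 3)"
    by (simp add: cocycle_group_def cocycles_3_iff cocycle3_uminus)
  then show "\<exists>g\<in>carrier (cocycle_group 3). g \<otimes>\<^bsub>cocycle_group 3\<^esub> f = \<one>\<^bsub>cocycle_group 3\<^esub>"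
    by (rule bexI[rotated]) (simp add: cocycle_group_def)
qed (auto simp: cocycle_group_def cocycles_3_iff cocycle3_add add.assoc)

lemma cocycle3_if_exact3: "exact3 f \<Longrightarrow> cocycle3 f"
  unfolding exact3_def by (metis (no_types, lifting) ext cocycle3_diff2)

text \<open>If every cocycle is exact, the coboundaries exhaust the cocycle group, and a group
  modulo itself has one coset.\<close>

lemma trivial_cohomology_3I:
  assumes "\<And>f. cocycle3 f \<Longrightarrow> exact3 f"
  shows "trivial_group (cohomology 3)"
proof -
  interpret group "cocycle_group 3"
    by (rule group_cocycle_group_3)
  have "exact3 f \<longleftrightarrow> cocycle3 f" for f
    using assms cocycle3_if_exact3 by blast
  then have "coboundaries 3 = carrier (cocycle_group 3)"
    by (auto simp: cocycle_group_def cocycles_3_iff coboundaries_3_iff)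
  then have "cohomology 3 = cocycle_group 3 Mod carrier (cocycle_group 3)"
    by (simp add: cohomology_def)
  moreover have "group (cocycle_group 3 Mod carrier (cocycle_group 3))"
    by (intro normal.factorgroup_is_group normal_self)
  moreover have "carrier (cocycle_group 3 Mod carrier (cocycle_group 3)) = {carrier (cocycle_group 3)}"
    using one_closed by (auto simp: carrier_FactGroup coset_join2 subgroup_self image_iff)
  ultimately show ?thesis
    by (simp add: trivial_group_def)
qed


text \<open>A primitive of the difference plus \<open>g\<close> is a primitive of \<open>f\<close>;
  every normalization step passes through this.\<close>

lemma exact3_if_cohomologous:
  assumes "bilin g" and "exact3 (\<lambda>a b c. f a b c - diff2 g a b c)"
  shows "exact3 f"
proof -
  obtain h where h: "bilin h" "\<And>a b c. f a b c - diff2 g a b c = diff2 h a b c"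
    using assms(2) by (auto simp: exact3_def)
  then have "f a b c = diff2 (\<lambda>a b. h a b + g a b) a b c" for a b c
    by (simp add: diff2_add flip: h(2))
  then show ?thesis
    unfolding exact3_def using bilin_add[OF h(1) assms(1)] by blast
qed

end

section \<open>Normalization of cocycles\<close>

text \<open>The algebra gains a unit, but its left and right actions on the bimodule are only
  commuting idempotents.\<close>

locale bimodule_ring_1 = bimodule scaleA scaleM lact ract
  for scaleA :: "'k::field \<Rightarrow> 'a::ring_1 \<Rightarrow> 'a" and scaleM :: "'k \<Rightarrow> 'm::ab_group_add \<Rightarrow> 'm"
    and lact ract
begin

lemma lact_one_lact: "lact 1 (lact a m) = lact a m" and lact_lact_one: "lact a (lact 1 m) = lact a m"
  by (simp_all flip: lact_assoc)

lemma ract_ract_one: "ract (ract m 1) a = ract m a"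
  by (simp flip: ract_assoc)

lemma lact_one_diff2:
  "(\<And>b c. lact 1 (g b c) = g b c) \<Longrightarrow> lact 1 (diff2 g a b c) = diff2 g a b c"
  by (simp add: diff2_def act_simps lact_one_lact flip: lact_ract_commute)

lemma exact3_if_lact_one_exact3:
  assumes f: "cocycle3 f" and "exact3 (\<lambda>a b c. lact 1 (f a b c))"
  shows "exact3 f"
proof (rule exact3_if_cohomologous)
  \<comment> \<open>On the complement \<open>(1 - 1\<cdot>)M\<close>, where the left action vanishes, \<open>f \<mapsto> f(1, -, -)\<close> is a
    contracting homotopy.\<close>
  let ?g = "\<lambda>b c. lact 1 (f 1 b c) - f 1 b c"
  show "bilin ?g"
    using f by (simp add: cocycle3_def trilin_def bilin_def lin_def act_simps)
  have "f a b c - diff2 ?g a b c = lact 1 (f a b c)" for a b c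
  proof -
    have d: "diff3 f 1 a b c = 0"
      using f by (simp add: cocycle3_def)
    \<comment> \<open>Under \<open>lact 1\<close> the first two terms of the cocycle identity at
      \<open>(1, a, b, c)\<close> cancel, so the \<open>lact 1\<close> part of
      \<open>diff2 ?g\<close> vanishes.\<close>
    have "lact 1 (diff3 f 1 a b c) =
        lact 1 (f 1 (a * b) c) - lact 1 (f 1 a (b * c)) + ract (lact 1 (f 1 a b)) c"
      by (simp add: diff3_def act_simps lact_one_lact lact_ract_commute)
    then have "lact 1 (f 1 (a * b) c) - lact 1 (f 1 a (b * c)) + ract (lact 1 (f 1 a b)) c = 0"
      by (simp add: d lact_zero_right)
    moreover have "diff2 ?g a b c = (f 1 (a * b) c - f 1 a (b * c) + ract (f 1 a b) c)
        - (lact 1 (f 1 (a * b) c) - lact 1 (f 1 a (b * c)) + ract (lact 1 (f 1 a b)) c)"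
      by (simp add: diff2_def act_simps lact_lact_one)
    ultimately have "diff2 ?g a b c = f 1 (a * b) c - f 1 a (b * c) + ract (f 1 a b) c"
      by (simp only: diff_zero)
    moreover have "f a b c - (f 1 (a * b) c - f 1 a (b * c) + ract (f 1 a b) c) = lact 1 (f a b c)"
      using d by (simp add: diff3_def algebra_simps)
    ultimately show ?thesis
      by (simp only:)
  qed
  then show "exact3 (\<lambda>a b c. f a b c - diff2 ?g a b c)"
    using assms(2) by simp
qed

text \<open>A unit in the third place is controlled only up to the right action, by
  \<open>normalized3_ract_one\<close>.\<close>

definition normalized3 :: "('a \<Rightarrow> 'a \<Rightarrow> 'a \<Rightarrow> 'm) \<Rightarrow> bool"
  where "normalized3 f \<longleftrightarrow>
    (\<forall>a b c. lact 1 (f a b c) = f a b c) \<and> (\<forall>b c. f 1 b c = 0) \<and> (\<forall>b c. f b 1 c = 0)"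

text \<open>Three reductions are applied in turn: replace \<open>f\<close> by \<open>lact 1\<close>
  of it, make it vanish on a unit in the first place (\<open>step1\<close>), then in the second
  (\<open>step2\<close>). Each preserves what the earlier ones achieved.\<close>

lemma exact3_if_normalized3_exact3:
  assumes normalized: "\<And>f. cocycle3 f \<Longrightarrow> normalized3 f \<Longrightarrow> exact3 f" and f: "cocycle3 f"
  shows "exact3 f"
proof -
  have step2: "exact3 f"
    if f: "cocycle3 f" and one: "\<And>a b c. lact 1 (f a b c) = f a b c" and first: "\<And>b c. f 1 b c = 0"
    for f
  proof (rule exact3_if_cohomologous)
    \<comment> \<open>The cocycle identity at \<open>(b, 1, 1, c)\<close> reads
      \<open>f b 1 c = ract (f b 1 1) c\<close>, which is \<open>diff2 ?g b 1 c\<close>.\<close>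
    let ?g = "\<lambda>b c. - f b 1 c"
    show g: "bilin ?g"
      using f by (simp add: cocycle3_def trilin_def bilin_def lin_def act_simps)
    have "diff2 ?g b 1 c = f b 1 c" for b c
    proof -
      have "diff3 f b 1 1 c = 0"
        using f by (simp add: cocycle3_def)
      then show ?thesis
        by (simp add: diff3_def diff2_def act_simps first)
    qed
    moreover have "diff2 ?g 1 b c = 0" for b c
      by (simp add: diff2_def act_simps first one)
    moreover have "lact 1 (diff2 ?g a b c) = diff2 ?g a b c" for a b c
      by (rule lact_one_diff2) (simp add: one act_simps)
    ultimately have "normalized3 (\<lambda>a b c. f a b c - diff2 ?g a b c)"
      by (simp add: normalized3_def first one lact_diff_right)
    then show "exact3 (\<lambda>a b c. f a b c - diff2 ?g a b c)"
      using normalized cocycle3_diff[OF f cocycle3_diff2[OF g]] by blast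
  qed
  have step1: "exact3 f"
    if f: "cocycle3 f" and one: "\<And>a b c. lact 1 (f a b c) = f a b c" for f
  proof (rule exact3_if_cohomologous)
    \<comment> \<open>The identity at \<open>(1, 1, b, c)\<close> gives
      \<open>f 1 b c = f 1 1 (b * c) - ract (f 1 1 b) c\<close>, which is
      \<open>diff2 ?g 1 b c\<close>.\<close>
    let ?g = "\<lambda>b c. lact b (f 1 1 c)"
    show g: "bilin ?g"
      using f by (simp add: cocycle3_def trilin_def bilin_def lin_def act_simps)
    have "diff2 ?g 1 b c = f 1 b c" for b c
    proof -
      have "diff3 f 1 1 b c = 0"
        using f by (simp add: cocycle3_def)
      then show ?thesis
        by (simp add: diff3_def diff2_def act_simps one lact_one_lact algebra_simps)
    qed
    moreover have "lact 1 (diff2 ?g a b c) = diff2 ?g a b c" for a b c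
      by (rule lact_one_diff2) (simp add: lact_one_lact)
    ultimately show "exact3 (\<lambda>a b c. f a b c - diff2 ?g a b c)"
      by (intro step2 cocycle3_diff[OF f cocycle3_diff2[OF g]]) (simp_all add: one lact_diff_right)
  qed
  have "cocycle3 (\<lambda>a b c. lact 1 (f a b c))"
  proof -
    have "diff3 (\<lambda>a b c. lact 1 (f a b c)) a b c d = lact 1 (diff3 f a b c d)" for a b c d
      by (simp add: diff3_def act_simps lact_one_lact lact_lact_one lact_ract_commute)
    then show ?thesis
      using f by (simp add: cocycle3_def trilin_def lin_def act_simps)
  qed
  then show ?thesis
    using exact3_if_lact_one_exact3[OF f] step1 by (simp add: lact_one_lact)
qed

text \<open>In the cocycle identity at \<open>(a, b, 1, 1)\<close> only
  \<open>ract (f a b 1) 1\<close> survives. This stands in for unitality on the right.\<close>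

lemma normalized3_ract_one:
  assumes "cocycle3 f" "normalized3 f"
  shows "ract (f a b 1) c = 0"
proof -
  have "diff3 f a b 1 1 = 0"
    using assms by (simp add: cocycle3_def)
  then have "ract (f a b 1) 1 = 0"
    using assms by (simp add: diff3_def normalized3_def act_simps)
  then show ?thesis
    by (metis ract_ract_one ract_zero_left)
qed

end

section \<open>Vanishing for the Weyl algebra\<close>

locale weyl_bimodule = bimodule weyl_scale scaleM lact ract
  for scaleM :: "'k::field_char_0 \<Rightarrow> 'm::ab_group_add \<Rightarrow> 'm" and lact ract

sublocale weyl_bimodule \<subseteq> bimodule_ring_1 weyl_scale scaleM lact ract ..

context weyl_bimodule
begin

lemma linD: "lin u \<Longrightarrow> u (a + b) = u a + u b" "lin u \<Longrightarrow> u (weyl_scale c a) = scaleM c (u a)"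
  by (simp_all add: lin_def)

text \<open>Left multiplication by \<open>weyl_p\<close> raises \<open>i\<close> in the basis
  \<open>weyl_monom i j\<close>, so the equation is a free recursion on \<open>i\<close> with
  initial values \<beta>. It yields both \<open>h\<close> and each \<open>g(-, c)\<close>
  below.\<close>

lemma ex_lin_p_recursion:
  assumes \<alpha>: "lin \<alpha>" "\<And>b. lact 1 (\<alpha> b) = \<alpha> b" and \<beta>: "\<And>j. lact 1 (\<beta> j) = \<beta> j"
  shows "\<exists>u. lin u \<and> (\<forall>b. lact 1 (u b) = u b) \<and> (\<forall>b. u (weyl_p * b) = lact weyl_p (u b) + \<alpha> b) \<and>
    (\<forall>j. u (weyl_monom 0 j) = \<beta> j)"
proof -
  define v where "v i j = rec_nat (\<beta> j) (\<lambda>i m. lact weyl_p m + \<alpha> (weyl_monom i j)) i" for i j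
  obtain u where u: "lin u" "\<And>i j. u (weyl_monom i j) = v i j"
    using ex_linear_on_weyl_monom[OF M.vector_space_axioms] unfolding linear_iff_lin by blast
  have "lact 1 (u b) = u b" for b
  proof (induction b rule: weyl_monom_induct)
    case (monom i j)
    show ?case
      by (cases i) (simp_all add: u v_def \<alpha> \<beta> act_simps lact_one_lact)
  qed (simp_all add: linD[OF u(1)] act_simps)
  moreover have "u (weyl_p * b) = lact weyl_p (u b) + \<alpha> b" for b
    by (induction b rule: weyl_monom_induct)
      (simp_all add: linD[OF u(1)] linD[OF \<alpha>(1)] act_simps p_times_weyl_monom u v_def distrib_left
        weyl.scale_mult_right)
  ultimately show ?thesis
    using u by (auto simp: v_def)
qed

text \<open>Once \<open>f\<close> vanishes with a generator in the first place, the cocycle identity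
  makes it commute with left multiplication by that generator in this place, and induction from
  \<open>f 1 b c = 0\<close> finishes.\<close>

lemma cocycle3_eq_0_if_generators:
  assumes f: "cocycle3 f" and one: "\<And>b c. f 1 b c = 0" and p: "\<And>b c. f weyl_p b c = 0"
    and q: "\<And>j c. f weyl_q (weyl_monom 0 j) c = 0" and qp: "\<And>c. f weyl_q weyl_p c = 0"
  shows "f a b c = 0"
proof -
  have lin: "lin (\<lambda>a. f a b c)" "lin (\<lambda>b. f a b c)" for a b c
    using f by (simp_all add: cocycle3_def trilin_def)
  have d: "lact a (f b c d) - f (a * b) c d + f a (b * c) d - f a b (c * d) + ract (f a b c) d = 0" for a b c d
    using f by (simp add: cocycle3_def diff3_def)
  have p_mult: "f (weyl_p * b) c d = lact weyl_p (f b c d)" for b c d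
    using d[of weyl_p b c d] by (simp add: p ract_zero_left)
  \<comment> \<open>The identity at \<open>(q, p, b, c)\<close> leaves
    \<open>f(q, pb, c) = f(qp, b, c)\<close>; rewriting \<open>qp = pq + 1\<close> gives
    \<open>p f(q, b, c)\<close>. This carries the vanishing on powers of \<open>q\<close> to all
    second arguments.\<close>
  have q_p_mult: "f weyl_q (weyl_p * b) c = lact weyl_p (f weyl_q b c)" for b c
    using d[of weyl_q weyl_p b c]
    by (simp add: p qp act_simps weyl_qp linD[OF lin(1)] p_mult one)
  have q_zero: "f weyl_q b c = 0" for b c
  proof (induction b rule: weyl_monom_induct)
    case (monom i j)
    show ?case
      by (induction i) (simp_all add: q q_p_mult act_simps flip: p_times_weyl_monom)
  qed (simp_all add: linD[OF lin(2)])
  have q_mult: "f (weyl_q * b) c d = lact weyl_q (f b c d)" for b c d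
    using d[of weyl_q b c d] by (simp add: q_zero ract_zero_left)
  show ?thesis
    by (induction a rule: weyl_induct)
      (simp_all add: one p_mult q_mult linD[OF lin(1)] act_simps)
qed

lemma exact3_normalized3:
  assumes f: "cocycle3 f" and norm: "normalized3 f"
  shows "exact3 f"
proof -
  have lin: "lin (\<lambda>a. f a b c)" "lin (\<lambda>b. f a b c)" "lin (\<lambda>c. f a b c)" for a b c
    using f by (simp_all add: cocycle3_def trilin_def)
  have lact_one: "lact 1 (f a b c) = f a b c"
    and f_one: "f 1 b c = 0" "f b 1 c = 0" for a b c
    using norm by (simp_all add: normalized3_def)
  \<comment> \<open>With \<open>g(p, -) = 0\<close>, \<open>g(1, -) = 0\<close> and
    \<open>g(q, -) = h\<close>, comparing \<open>f\<close> with \<open>diff2 g\<close> at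
    \<open>(q, p, c)\<close> requires \<open>h(pc) = p h(c) + ?\<phi>(c)\<close>, provided
    \<open>h(p)\<close> is killed by the right action.\<close>
  let ?\<phi> = "\<lambda>c. f weyl_q weyl_p c - f weyl_p weyl_q c"
  have "lin ?\<phi>"
    using linD[OF lin(3)] by (simp add: lin_def M.scale_right_diff_distrib)
  then obtain h where h: "lin h" "\<And>b. lact 1 (h b) = h b"
      "\<And>b. h (weyl_p * b) = lact weyl_p (h b) + ?\<phi> b" "\<And>j. h (weyl_monom 0 j) = 0"
    using ex_lin_p_recursion[of ?\<phi> "\<lambda>_. 0"] by (auto simp: act_simps lact_one)
  \<comment> \<open>Since \<open>h(1) = 0\<close>, the recursion gives
    \<open>h(p) = ?\<phi>(1)\<close>, a combination of values of \<open>f\<close> with third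
    argument 1.\<close>
  have ract_h_p: "ract (h weyl_p) c = 0" for c
    using h(3)[of 1] h(4)[of 0] normalized3_ract_one[OF f norm]
    by (simp add: weyl_monom_0_0 act_simps)
  \<comment> \<open>\<beta> is \<open>g(q^j, c)\<close>, solved from \<open>diff2 g = f\<close> at
    \<open>(q, q^j, c)\<close>; the term with the right action drops out because
    \<open>h(q^j) = 0\<close>.\<close>
  define \<beta> where "\<beta> c j = rec_nat 0
    (\<lambda>j m. lact weyl_q m + h (weyl_monom 0 j * c) - f weyl_q (weyl_monom 0 j) c) j" for c j
  have \<beta>: "\<beta> c 0 = 0"
    "\<beta> c (Suc j) = lact weyl_q (\<beta> c j) + h (weyl_monom 0 j * c) - f weyl_q (weyl_monom 0 j) c" for c j
    by (simp_all add: \<beta>_def)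
  have "\<exists>u. lin u \<and> (\<forall>b. lact 1 (u b) = u b) \<and>
      (\<forall>b. u (weyl_p * b) = lact weyl_p (u b) + - f weyl_p b c) \<and> (\<forall>j. u (weyl_monom 0 j) = \<beta> c j)" for c
  proof (rule ex_lin_p_recursion)
    show "lin (\<lambda>b. - f weyl_p b c)"
      using linD[OF lin(2)] by (simp add: lin_def M.scale_minus_right)
    show "lact 1 (- f weyl_p b c) = - f weyl_p b c" for b
      by (simp add: act_simps lact_one)
    show "lact 1 (\<beta> c j) = \<beta> c j" for j
      by (cases j) (simp_all add: \<beta> act_simps lact_one lact_one_lact h)
  qed
  then obtain u where u: "\<And>c. lin (u c)" "\<And>c b. lact 1 (u c b) = u c b"
      "\<And>c b. u c (weyl_p * b) = lact weyl_p (u c b) + - f weyl_p b c"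
      "\<And>c j. u c (weyl_monom 0 j) = \<beta> c j"
    by metis
  define g where "g b c = u c b" for b c
  have g: "lin (\<lambda>b. g b c)" "lact 1 (g b c) = g b c"
      "g (weyl_p * b) c = lact weyl_p (g b c) - f weyl_p b c" "g (weyl_monom 0 j) c = \<beta> c j" for b c j
    by (simp_all add: g_def u)
  \<comment> \<open>Each \<open>u c\<close> was chosen separately for its \<open>c\<close>.
    Linearity in \<open>c\<close> follows because the recursions determine \<open>g\<close> on
    monomials from data linear in \<open>c\<close>.\<close>
  have \<beta>_lin: "lin (\<lambda>c. \<beta> c j)" for j
    by (induction j)
      (simp_all add: \<beta> lin_def act_simps linD[OF h(1)] linD[OF lin(3)] distrib_left weyl.scale_mult_right)
  have "lin (\<lambda>c. g b c)" for b
  proof (induction b rule: weyl_monom_induct)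
    case (monom i j)
    show ?case
    proof (induction i)
      case (Suc i)
      then show ?case
        by (simp add: lin_def g act_simps linD[OF lin(3)] flip: p_times_weyl_monom)
    qed (simp add: g \<beta>_lin)
  qed (simp_all add: lin_def linD[OF g(1)] act_simps algebra_simps M.scale_left_commute)
  with g(1) have bilin: "bilin g"
    by (simp add: bilin_def)
  have g_one: "g 1 c = 0" for c
    using g(4)[of 0] by (simp add: weyl_monom_0_0 \<beta>)
  have g_p: "g weyl_p c = 0" for c
    using g(3)[of 1] by (simp add: g_one f_one act_simps)
  \<comment> \<open>The value at \<open>j = 1\<close> agrees with the intended \<open>h\<close>
    because \<open>f q 1 c = 0\<close>.\<close>
  have g_q: "g weyl_q c = h c" for c
    using g(4)[of "Suc 0"] by (simp add: weyl_monom_def \<beta> f_one act_simps)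
  let ?f = "\<lambda>a b c. f a b c - diff2 g a b c"
  have "?f a b c = 0" for a b c
  proof (rule cocycle3_eq_0_if_generators)
    show "cocycle3 ?f"
      by (rule cocycle3_diff[OF f cocycle3_diff2[OF bilin]])
    \<comment> \<open>The terms \<open>lact 1 (g b c)\<close> and \<open>g b c\<close> cancel
      because \<open>g\<close> takes values fixed by \<open>lact 1\<close>.\<close>
    show "?f 1 b c = 0" for b c
      by (simp add: diff2_def f_one g_one g(2) act_simps)
    show "?f weyl_p b c = 0" for b c
      by (simp add: diff2_def g(3) g_p act_simps)
    show "?f weyl_q (weyl_monom 0 j) c = 0" for j c
      by (simp add: diff2_def g(4) g_q act_simps q_times_weyl_monom_0 h(4) \<beta>)
    show "?f weyl_q weyl_p c = 0" for c
      by (simp add: diff2_def g_p g_q weyl_qp linD[OF g(1)] g(3) g_one h(3) ract_h_p act_simps)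
  qed
  then show ?thesis
    unfolding exact3_def using bilin by auto
qed

theorem trivial_cohomology_3: "trivial_group (cohomology 3)"
  by (rule trivial_cohomology_3I, rule exact3_if_normalized3_exact3[OF exact3_normalized3])

end

theorem theorem4p3:
  fixes scaleM :: "'k::field_char_0 \<Rightarrow> 'm::ab_group_add \<Rightarrow> 'm"
    and lact :: "'k weyl \<Rightarrow> 'm \<Rightarrow> 'm"
    and ract :: "'m \<Rightarrow> 'k weyl \<Rightarrow> 'm"
  assumes "bimodule weyl_scale scaleM lact ract"
  shows "trivial_group (bimodule.cohomology weyl_scale scaleM lact ract 3)"
proof -
  interpret weyl_bimodule scaleM lact ract
    using assms by (simp add: weyl_bimodule_def)
  show ?thesis by (rule trivial_cohomology_3)
qed

end
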